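(* Denote the following two-dimensional Kontsevich graphs on three Levi-Civita vertices $1,2,3$ and one sink $0$ by $\Gamma_1=[0,1;2,3;1,3]$, $\Gamma_2=[0,1;1,2;1,3]$, $\Gamma_3=[0,3;2,3;2,3]$, $\Gamma_4=[0,3;2,3;1,3]$, $\Gamma_5=[0,2;2,3;1,3]$, $\Gamma_6=[0,3;1,2;1,3]$, $\Gamma_7=[0,3;2,3;1,2]$, $\Gamma_8=[0,3;1,2;1,2]$, $\Gamma_9=[0,2;2,3;1,2]$, $\Gamma_{10}=[0,2;1,2;1,2]$, $\Gamma_{11}=[0,1;1,3;1,2]$, $\Gamma_{12}=[0,3;1,3;1,2]$, $\Gamma_{13}=[0,1;1,3;2,3]$, $\Gamma_{14}=[0,1;1,3;1,3]$ (these are pairwise nonisomorphic). Their images under the morphism $\phi$ from graphs to vector fields on $\mathbb{R}^2$ satisfy $$\phi(\Gamma_1)=\phi(\Gamma_5)=\phi(\Gamma_6)=-\phi(\Gamma_7)=\tfrac12\phi(\Gamma_8)=\phi(\Gamma_{12})=\phi(\Gamma_{13}),$$ $$\phi(\Gamma_2)=\phi(\Gamma_4)=-\phi(\Gamma_9)=\phi(\Gamma_{11}),\qquad \phi(\Gamma_3)=\phi(\Gamma_{10})=\phi(\Gamma_{14}).$$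
   Context: In the encoding $[t_{11},t_{12};t_{21},t_{22};t_{31},t_{32}]$, the Levi-Civita vertex $k\in\{1,2,3\}$ issues two ordered directed edges, to the vertices $t_{k1}$ and $t_{k2}$; the sink $0$ issues no edges. The vector field $\phi(\Gamma)$ on $\mathbb{R}^2$ (with coordinates $x^1=x$, $x^2=y$ and an arbitrary smooth function $\varrho(x,y)$, the coefficient of the Poisson bivector $P=\varrho\,\partial_x\wedge\partial_y$) is defined as follows: decorate the edges of vertex $k$ with indices $i_{k1},i_{k2}\in\{1,2\}$; form $\prod_{k=1}^3\varepsilon^{i_{k1}i_{k2}}$ ($\varepsilon$ the Levi-Civita symbol, $\varepsilon^{12}=1$) times the product over $k=1,2,3$ of $\varrho$ differentiated with respect to $x^i$ for each edge with index $i$ entering vertex $k$, times $\partial_{x^i}$ where $i$ is the index of the edge entering the sink; sum over all indices. Equalities hold identically in $\varrho$. *)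

theory Defs
  imports "HOL-Analysis.Analysis" "HOL-Combinatorics.Permutations" "HOL-Library.Multiset"
begin

section \<open>Smooth functions and partial derivatives\<close>

text \<open>Recursive definition of class \<open>C\<^sup>k\<close> in terms of (directional) derivatives.\<close>

primrec Ck :: "nat \<Rightarrow> ('a::real_normed_vector \<Rightarrow> 'b::real_normed_vector) \<Rightarrow> bool" where
  "Ck 0 f \<longleftrightarrow> continuous_on UNIV f"
| "Ck (Suc k) f \<longleftrightarrow>
     (\<forall>x. f differentiable (at x)) \<and> (\<forall>v. Ck k (\<lambda>x. frechet_derivative f (at x) v))"

definition smooth :: "('a::real_normed_vector \<Rightarrow> 'b::real_normed_vector) \<Rightarrow> bool" where
  "smooth f \<longleftrightarrow> (\<forall>k. Ck k f)"

text \<open>The indices \<open>1, 2\<close> of the coordinates \<open>x\<^sup>1 = x\<close>, \<open>x\<^sup>2 = y\<close> are the two elements of the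
  type \<open>2\<close>.\<close>

definition partial :: "2 \<Rightarrow> (real^2 \<Rightarrow> real) \<Rightarrow> real^2 \<Rightarrow> real" where
  "partial i f p = frechet_derivative f (at p) (axis i 1)"

definition levi_civita :: "2 \<Rightarrow> 2 \<Rightarrow> real" where
  "levi_civita i j = (if i = j then 0 else if i = 1 then 1 else -1)"

section \<open>Kontsevich graphs with one sink\<close>

text \<open>The list \<open>[(t\<^sub>1\<^sub>1,t\<^sub>1\<^sub>2), \<dots>, (t\<^sub>n\<^sub>1,t\<^sub>n\<^sub>2)]\<close> encodes the graph whose Levi-Civita vertices are
  \<open>1, \<dots>, n\<close>, whose sink is \<open>0\<close>, and in which vertex \<open>k\<close> issues a first edge to \<open>t\<^sub>k\<^sub>1\<close> and a
  second edge to \<open>t\<^sub>k\<^sub>2\<close>.\<close>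

type_synonym kgraph = "(nat \<times> nat) list"

text \<open>Vertices are counted from 1, list positions from 0.\<close>

definition targets :: "kgraph \<Rightarrow> nat \<Rightarrow> nat \<times> nat" where
  "targets g k = g ! (k - 1)"

text \<open>Isomorphism of directed graphs over the sink. The order of the two edges issued from a
  vertex is not required to be preserved, which is the coarsest choice, so that
  non-isomorphism in this sense implies non-isomorphism as graphs with ordered edges.\<close>

definition isomorphic :: "kgraph \<Rightarrow> kgraph \<Rightarrow> bool" where
  "isomorphic g h \<longleftrightarrow> length g = length h \<and>
     (\<exists>\<pi>. \<pi> permutes {1..length g} \<and>
        (\<forall>k\<in>{1..length g}.
           {#\<pi> (fst (targets g k)), \<pi> (snd (targets g k))#} =
           {#fst (targets h (\<pi> k)), snd (targets h (\<pi> k))#}))"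

section \<open>The vector field of a graph\<close>

text \<open>A decoration lists, for each Levi-Civita vertex, the pair of indices on its two
  outgoing edges.\<close>

type_synonym decoration = "(2 \<times> 2) list"

definition decorated_edges :: "kgraph \<Rightarrow> decoration \<Rightarrow> (nat \<times> 2) list" where
  "decorated_edges g d =
     concat (map2 (\<lambda>(s, t) (i, j). [(s, i), (t, j)]) g d)"

text \<open>The indices on the edges entering the vertex \<open>v\<close>. They are collected in a list because
  of their multiplicities; their order is irrelevant for the derivatives of a smooth function.\<close>

definition in_indices :: "kgraph \<Rightarrow> decoration \<Rightarrow> nat \<Rightarrow> 2 list" where
  "in_indices g d v = map snd (filter (\<lambda>e. fst e = v) (decorated_edges g d))"

text \<open>Only meant for graphs in which exactly one edge enters the sink, whose index is then the
  head of the list of indices entering \<open>0\<close>. The vector field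
  \<open>X\<^sup>1 \<partial>\<^sub>x + X\<^sup>2 \<partial>\<^sub>y\<close> is given by its components \<open>(X\<^sup>1, X\<^sup>2)\<close>.\<close>

definition phi :: "kgraph \<Rightarrow> (real^2 \<Rightarrow> real) \<Rightarrow> real^2 \<Rightarrow> real^2" where
  "phi g \<rho> p =
     (\<Sum>d\<in>{d :: decoration. length d = length g}.
        ((\<Prod>(i, j)\<leftarrow>d. levi_civita i j) *
         (\<Prod>k=1..length g. foldr partial (in_indices g d k) \<rho> p))
        *\<^sub>R axis (hd (in_indices g d 0)) 1)"

section \<open>The fourteen graphs\<close>

definition KGamma :: "nat \<Rightarrow> kgraph" where
  "KGamma n =
    [ [(0,1), (2,3), (1,3)],
      [(0,1), (1,2), (1,3)],
      [(0,3), (2,3), (2,3)],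
      [(0,3), (2,3), (1,3)],
      [(0,2), (2,3), (1,3)],
      [(0,3), (1,2), (1,3)],
      [(0,3), (2,3), (1,2)],
      [(0,3), (1,2), (1,2)],
      [(0,2), (2,3), (1,2)],
      [(0,2), (1,2), (1,2)],
      [(0,1), (1,3), (1,2)],
      [(0,3), (1,3), (1,2)],
      [(0,1), (1,3), (2,3)],
      [(0,1), (1,3), (1,3)] ] ! (n - 1)"

lemma KGamma_one_edge_to_sink:
  assumes "n \<in> {1..14}"
  shows "\<exists>i. in_indices (KGamma n) [(a,b),(a',b'),(a'',b'')] 0 = [i]"
proof -
  have "n \<in> set [1..<15]" using assms by auto
  then show ?thesis
    by (auto simp: KGamma_def in_indices_def decorated_edges_def upt_rec numeral_eq_Suc)
qed

end

theory Submission
  imports Defs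
begin

text \<open>Only the eight decorations in which every vertex carries two distinct indices contribute to
  a vector field, so each \<open>\<phi>(\<Gamma>)\<close> is a differential polynomial in \<open>\<rho>\<close> with at most eight terms per
  component. Partial derivatives of a smooth function commute, and after sorting them the claimed
  equalities are polynomial identities. A non-isomorphism is checked on the six permutations of the
  three vertices.\<close>

section \<open>Symmetry of second derivatives\<close>

text \<open>Chain rule along the line through \<open>a\<close> in direction \<open>v\<close>. It
  turns directional derivatives into derivatives of functions of one real variable, to which the
  mean value theorem applies.\<close>

lemma has_real_derivative_along_line:
  fixes f :: "'a::real_normed_vector \<Rightarrow> real"
  assumes "f differentiable at (a + s *\<^sub>R v)"
  shows "((\<lambda>s. f (a + s *\<^sub>R v)) has_real_derivative frechet_derivative f (at (a + s *\<^sub>R v)) v) (at s)"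
proof -
  let ?f' = "frechet_derivative f (at (a + s *\<^sub>R v))"
  have f': "(f has_derivative ?f') (at (a + s *\<^sub>R v))"
    using assms by (simp add: frechet_derivative_works)
  have "((\<lambda>s. a + s *\<^sub>R v) has_derivative (\<lambda>t. t *\<^sub>R v)) (at s)"
    by (auto intro!: derivative_eq_intros)
  from has_derivative_compose[OF this f']
  have "((\<lambda>s. f (a + s *\<^sub>R v)) has_derivative (\<lambda>t. ?f' (t *\<^sub>R v))) (at s)" .
  moreover have "?f' (t *\<^sub>R v) = ?f' v * t" for t
    using linear_scale[OF has_derivative_linear[OF f']] by simp
  ultimately show ?thesis
    by (simp add: has_field_derivative_def)
qed

text \<open>The second difference is the increment over [0, h] of the function sending s to f(x + h
  w + s v) - f(x + s v). The mean value theorem in direction \<open>v\<close> produces one factor h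
  and the point \<open>s\<close>; applied once more, in direction \<open>w\<close>, to the
  derivative along \<open>v\<close>, it produces the other factor and \<open>t\<close>.\<close>

lemma second_difference_mean_value:
  fixes f :: "'a::real_normed_vector \<Rightarrow> real"
  assumes f: "\<And>x. f differentiable at x"
    and f': "\<And>x. (\<lambda>y. frechet_derivative f (at y) v) differentiable at x"
    and "0 < h"
  obtains s t where "0 < s" "s < h" "0 < t" "t < h"
    "f (x + h *\<^sub>R v + h *\<^sub>R w) - f (x + h *\<^sub>R v) - f (x + h *\<^sub>R w) + f x =
     h\<^sup>2 * frechet_derivative (\<lambda>y. frechet_derivative f (at y) v) (at (x + s *\<^sub>R v + t *\<^sub>R w)) w"
proof -
  let ?D = "\<lambda>y. frechet_derivative f (at y) v"
  have "((\<lambda>s. f ((x + h *\<^sub>R w) + s *\<^sub>R v) - f (x + s *\<^sub>R v)) has_real_derivative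
      ?D ((x + h *\<^sub>R w) + s *\<^sub>R v) - ?D (x + s *\<^sub>R v)) (at s)" for s
    by (intro DERIV_diff has_real_derivative_along_line f)
  from MVT2[OF \<open>0 < h\<close> this] obtain s where s: "0 < s" "s < h"
    and eq1: "f ((x + h *\<^sub>R w) + h *\<^sub>R v) - f (x + h *\<^sub>R v) - (f (x + h *\<^sub>R w) - f x) =
      h * (?D ((x + h *\<^sub>R w) + s *\<^sub>R v) - ?D (x + s *\<^sub>R v))"
    by auto
  have "((\<lambda>t. ?D ((x + s *\<^sub>R v) + t *\<^sub>R w)) has_real_derivative
      frechet_derivative ?D (at ((x + s *\<^sub>R v) + t *\<^sub>R w)) w) (at t)" for t
    by (intro has_real_derivative_along_line f')
  from MVT2[OF \<open>0 < h\<close> this] obtain t where t: "0 < t" "t < h"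
    and eq2: "?D ((x + s *\<^sub>R v) + h *\<^sub>R w) - ?D (x + s *\<^sub>R v) =
      h * frechet_derivative ?D (at ((x + s *\<^sub>R v) + t *\<^sub>R w)) w"
    by auto
  show thesis
    using that[OF s t] eq1 eq2 by (simp add: algebra_simps power2_eq_square)
qed

text \<open>The second difference is symmetric in \<open>v\<close> and \<open>w\<close>. Divided by
  the square of the step, it tends to the mixed derivative in either order, because the mean value
  points tend to \<open>x\<close> and second derivatives are continuous; uniqueness of limits
  concludes.\<close>

lemma frechet_derivative_commute:
  fixes f :: "'a::real_normed_vector \<Rightarrow> real"
  assumes f: "\<And>x. f differentiable at x"
    and f': "\<And>v x. (\<lambda>y. frechet_derivative f (at y) v) differentiable at x"
    and f'': "\<And>v w. continuous_on UNIV
      (\<lambda>x. frechet_derivative (\<lambda>y. frechet_derivative f (at y) v) (at x) w)"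
  shows "frechet_derivative (\<lambda>y. frechet_derivative f (at y) v) (at x) w =
    frechet_derivative (\<lambda>y. frechet_derivative f (at y) w) (at x) v"
proof -
  let ?D = "\<lambda>v w x. frechet_derivative (\<lambda>y. frechet_derivative f (at y) v) (at x) w"
  let ?h = "\<lambda>n. inverse (real (Suc n))"
  let ?\<Delta> = "\<lambda>v w n. f (x + ?h n *\<^sub>R v + ?h n *\<^sub>R w) - f (x + ?h n *\<^sub>R v) - f (x + ?h n *\<^sub>R w) + f x"
  have lim: "(\<lambda>n. ?\<Delta> v w n / (?h n)\<^sup>2) \<longlonglongrightarrow> ?D v w x" for v w
  proof -
    have "\<exists>s t. 0 < s \<and> s < ?h n \<and> 0 < t \<and> t < ?h n \<and>
        ?\<Delta> v w n = (?h n)\<^sup>2 * ?D v w (x + s *\<^sub>R v + t *\<^sub>R w)" for n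
      by (rule second_difference_mean_value[OF f f', of "?h n" x v w]) auto
    then obtain s t where st: "\<And>n. 0 < s n" "\<And>n. s n < ?h n" "\<And>n. 0 < t n" "\<And>n. t n < ?h n"
      and eq: "\<And>n. ?\<Delta> v w n = (?h n)\<^sup>2 * ?D v w (x + s n *\<^sub>R v + t n *\<^sub>R w)"
      by metis
    \<comment> \<open>Both parameters are squeezed between 0 and the step size 1/(n+1), so the
      intermediate points converge to \<open>x\<close>.\<close>
    have "u \<longlonglongrightarrow> 0" if "\<And>n. 0 < u n" "\<And>n. u n < ?h n" for u :: "nat \<Rightarrow> real"
      using that by (intro tendsto_sandwich[OF _ _ tendsto_const LIMSEQ_inverse_real_of_nat])
        (auto intro!: always_eventually simp: less_imp_le simp del: of_nat_Suc)
    from this[OF st(1,2)] this[OF st(3,4)]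
    have "(\<lambda>n. x + s n *\<^sub>R v + t n *\<^sub>R w) \<longlonglongrightarrow> x"
      by (auto intro!: tendsto_eq_intros)
    moreover have "isCont (?D v w) x"
      using f'' by (simp add: continuous_on_eq_continuous_at)
    ultimately have "(\<lambda>n. ?D v w (x + s n *\<^sub>R v + t n *\<^sub>R w)) \<longlonglongrightarrow> ?D v w x"
      by (rule isCont_tendsto_compose[rotated])
    moreover have "?\<Delta> v w n / (?h n)\<^sup>2 = ?D v w (x + s n *\<^sub>R v + t n *\<^sub>R w)" for n
      by (subst eq) (simp del: of_nat_Suc)
    ultimately show ?thesis
      by simp
  qed
  \<comment> \<open>Exchanging \<open>v\<close> and \<open>w\<close> only exchanges the two middle
    terms of \<open>?\<Delta>\<close>.\<close>
  have "(\<lambda>n. ?\<Delta> w v n / (?h n)\<^sup>2) = (\<lambda>n. ?\<Delta> v w n / (?h n)\<^sup>2)"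
    by (simp add: fun_eq_iff algebra_simps)
  with lim[of w v] show ?thesis
    by (simp only: LIMSEQ_unique[OF lim[of v w]])
qed

lemma smooth_continuous_on: "smooth f \<Longrightarrow> continuous_on UNIV f"
  unfolding smooth_def by (metis Ck.simps(1))

lemma smooth_differentiable: "smooth f \<Longrightarrow> f differentiable at x"
  unfolding smooth_def by (metis Ck.simps(2))

lemma smooth_frechet_derivative: "smooth f \<Longrightarrow> smooth (\<lambda>x. frechet_derivative f (at x) v)"
  unfolding smooth_def by (metis Ck.simps(2))

lemma smooth_partial: "smooth \<rho> \<Longrightarrow> smooth (partial i \<rho>)"
  using smooth_frechet_derivative[of \<rho> "axis i 1"] by (simp add: partial_def[abs_def])

lemma partial_commute:
  assumes "smooth \<rho>"
  shows "partial i (partial j \<rho>) = partial j (partial i \<rho>)"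
  unfolding partial_def[abs_def]
  by (rule ext, rule frechet_derivative_commute)
    (intro smooth_differentiable smooth_continuous_on smooth_frechet_derivative assms)+

section \<open>Graphs with three Levi-Civita vertices\<close>

lemma sum_decorations_three:
  fixes F :: "decoration \<Rightarrow> 'a::comm_monoid_add"
  shows "(\<Sum>d | length d = 3. F d) = (\<Sum>x\<in>UNIV. \<Sum>y\<in>UNIV. \<Sum>z\<in>UNIV. F [x, y, z])"
proof -
  have "{d :: decoration. length d = 3} = (\<lambda>(x, y, z). [x, y, z]) ` UNIV"
    by (force simp: length_Suc_conv numeral_3_eq_3 image_iff)
  moreover have "inj (\<lambda>(x, y, z). [x, y, z] :: decoration)"
    by (auto simp: inj_on_def)
  ultimately show ?thesis
    by (simp add: sum.reindex sum.cartesian_product split_def)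
qed

text \<open>The hypotheses hold for any summand with the Levi-Civita factor of the vertex. Used once
  per vertex, this cuts the 64 decorations down to 8.\<close>

lemma sum_index_pairs:
  fixes F :: "2 \<times> 2 \<Rightarrow> 'a::comm_monoid_add"
  assumes "F (1, 1) = 0" "F (2, 2) = 0"
  shows "(\<Sum>x\<in>UNIV. F x) = F (1, 2) + F (2, 1)"
proof -
  have UNIV: "UNIV = {(1, 1), (1, 2), (2, 1), (2, 2) :: 2 \<times> 2}"
    using exhaust_2 by auto
  show ?thesis
    unfolding UNIV by (simp add: assms)
qed

text \<open>The sums and the product run over literal lists, so for a concrete graph the simplifier
  unfolds the right-hand side into an explicit expression in the derivatives of
  \<open>\<rho>\<close>. The test on the index entering the sink is component \<open>i\<close> of
  the basis vector.\<close>

lemma phi_three_component: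
  "phi [a, b, c] \<rho> p $ i =
    (\<Sum>x\<leftarrow>[(1, 2), (2, 1)]. \<Sum>y\<leftarrow>[(1, 2), (2, 1)]. \<Sum>z\<leftarrow>[(1, 2), (2, 1)].
      if hd (in_indices [a, b, c] [x, y, z] 0) = i
      then levi_civita (fst x) (snd x) * levi_civita (fst y) (snd y) * levi_civita (fst z) (snd z) *
        (\<Prod>k\<leftarrow>[1, 2, 3]. foldr partial (in_indices [a, b, c] [x, y, z] k) \<rho> p)
      else 0)"
proof -
  have "{1..length [a, b, c]} = {1, 2, 3}" "length [a, b, c] = 3"
    by auto
  then show ?thesis
    unfolding phi_def
    by (simp only: sum_decorations_three)
      (simp add: sum_index_pairs levi_civita_def split_def mult.assoc axis_def)
qed

text \<open>The list \<open>\<sigma>\<close> is the table of values at \<open>0, 1, 2, 3\<close> of an isomorphism fixing the sink.\<close>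

definition relabels :: "nat list \<Rightarrow> kgraph \<Rightarrow> kgraph \<Rightarrow> bool" where
  "relabels \<sigma> g h \<longleftrightarrow> (\<forall>k\<in>set [1, 2, 3].
     let (s, t) = targets g k; (s', t') = targets h (\<sigma> ! k)
     in \<sigma> ! s = s' \<and> \<sigma> ! t = t' \<or> \<sigma> ! s = t' \<and> \<sigma> ! t = s')"

text \<open>This replaces the quantifier over permutations by six tables. The bound on the targets
  keeps every lookup inside a table, whose positions are 0 to 3.\<close>

lemma isomorphic_three_imp_relabels:
  assumes "isomorphic g h" "length g = 3" "\<forall>(s, t)\<in>set g. s \<le> 3 \<and> t \<le> 3"
  shows "\<exists>\<sigma>\<in>set [[0, 1, 2, 3], [0, 1, 3, 2], [0, 2, 1, 3], [0, 2, 3, 1], [0, 3, 1, 2], [0, 3, 2, 1]].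
    relabels \<sigma> g h"
proof -
  obtain \<pi> where \<pi>: "\<pi> permutes {1..3}"
    and iso: "\<And>k. k \<in> {1..3} \<Longrightarrow> {#\<pi> (fst (targets g k)), \<pi> (snd (targets g k))#} =
      {#fst (targets h (\<pi> k)), snd (targets h (\<pi> k))#}"
    using assms by (auto simp: isomorphic_def)
  define \<sigma> where "\<sigma> = map \<pi> [0, 1, 2, 3]"
  have \<sigma>: "\<sigma> ! v = \<pi> v" if "v \<le> 3" for v
  proof -
    have "v = 0 \<or> v = 1 \<or> v = 2 \<or> v = 3"
      using that by linarith
    then show ?thesis
      by (auto simp: \<sigma>_def)
  qed
  have "relabels \<sigma> g h"
    unfolding relabels_def
  proof
    fix k :: nat
    assume "k \<in> set [1, 2, 3]"
    then have k: "k \<in> {1..3}"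
      by auto
    then have "targets g k \<in> set g"
      using assms(2) by (auto simp: targets_def)
    \<comment> \<open>Two-element multisets agree exactly when their entries agree in one of the two
      orders.\<close>
    then show "let (s, t) = targets g k; (s', t') = targets h (\<sigma> ! k)
      in \<sigma> ! s = s' \<and> \<sigma> ! t = t' \<or> \<sigma> ! s = t' \<and> \<sigma> ! t = s'"
      using assms(3) iso[OF k] k by (auto simp: \<sigma> add_eq_conv_ex split: prod.splits)
  qed
  moreover have "\<sigma> \<in> set [[0, 1, 2, 3], [0, 1, 3, 2], [0, 2, 1, 3], [0, 2, 3, 1], [0, 3, 1, 2], [0, 3, 2, 1]]"
  proof -
    \<comment> \<open>The sink lies outside the permuted set; together with injectivity on 1, 2, 3
      this leaves six of the 27 value combinations.\<close>
    have "\<pi> 0 = 0"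
      using permutes_not_in[OF \<pi>] by simp
    moreover have "\<pi> 1 \<noteq> \<pi> 2" "\<pi> 1 \<noteq> \<pi> 3" "\<pi> 2 \<noteq> \<pi> 3"
      using permutes_inj[OF \<pi>] by (simp_all add: inj_eq)
    moreover have "\<pi> k = 1 \<or> \<pi> k = 2 \<or> \<pi> k = 3" if "k \<in> {1..3}" for k
      using that permutes_in_image[OF \<pi>, of k] by auto
    from this[of 1] this[of 2] this[of 3]
    have "\<pi> 1 = 1 \<or> \<pi> 1 = 2 \<or> \<pi> 1 = 3" "\<pi> 2 = 1 \<or> \<pi> 2 = 2 \<or> \<pi> 2 = 3" "\<pi> 3 = 1 \<or> \<pi> 3 = 2 \<or> \<pi> 3 = 3"
      by auto
    ultimately show ?thesis
      unfolding \<sigma>_def by (elim disjE) simp_all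
  qed
  ultimately show ?thesis
    by blast
qed

text \<open>With all quantifiers bounded by explicit lists the statement is executable: 182 ordered
  pairs of graphs with six tables each are decided by evaluation.\<close>

lemma KGamma_not_relabels:
  "\<forall>i\<in>set [1..<15]. \<forall>j\<in>set [1..<15]. i \<noteq> j \<longrightarrow>
    (\<forall>\<sigma>\<in>set [[0, 1, 2, 3], [0, 1, 3, 2], [0, 2, 1, 3], [0, 2, 3, 1], [0, 3, 1, 2], [0, 3, 2, 1]].
      \<not> relabels \<sigma> (KGamma i) (KGamma j))"
  by code_simp

lemma KGamma_three_vertices:
  "\<forall>i\<in>set [1..<15]. length (KGamma i) = 3 \<and> (\<forall>(s, t)\<in>set (KGamma i). s \<le> 3 \<and> t \<le> 3)"
  by code_simp

lemma KGamma_not_isomorphic: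
  assumes "i \<in> {1..14}" "j \<in> {1..14}" "i \<noteq> j"
  shows "\<not> isomorphic (KGamma i) (KGamma j)"
proof -
  have "i \<in> set [1..<15]" "j \<in> set [1..<15]"
    using assms by auto
  then show ?thesis
    using isomorphic_three_imp_relabels[of "KGamma i" "KGamma j"] KGamma_three_vertices
      KGamma_not_relabels \<open>i \<noteq> j\<close> by blast
qed

theorem claim2:
  shows "(\<forall>i\<in>{1..14}. \<forall>j\<in>{1..14}. i \<noteq> j \<longrightarrow> \<not> isomorphic (KGamma i) (KGamma j)) \<and>
    (\<forall>\<rho> :: real^2 \<Rightarrow> real. smooth \<rho> \<longrightarrow> (\<forall>p.
       (phi (KGamma 1) \<rho> p = phi (KGamma 5) \<rho> p \<and>
        phi (KGamma 5) \<rho> p = phi (KGamma 6) \<rho> p \<and>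
        phi (KGamma 6) \<rho> p = - phi (KGamma 7) \<rho> p \<and>
        - phi (KGamma 7) \<rho> p = (1/2) *\<^sub>R phi (KGamma 8) \<rho> p \<and>
        (1/2) *\<^sub>R phi (KGamma 8) \<rho> p = phi (KGamma 12) \<rho> p \<and>
        phi (KGamma 12) \<rho> p = phi (KGamma 13) \<rho> p) \<and>
       (phi (KGamma 2) \<rho> p = phi (KGamma 4) \<rho> p \<and>
        phi (KGamma 4) \<rho> p = - phi (KGamma 9) \<rho> p \<and>
        - phi (KGamma 9) \<rho> p = phi (KGamma 11) \<rho> p) \<and>
       (phi (KGamma 3) \<rho> p = phi (KGamma 10) \<rho> p \<and>
        phi (KGamma 10) \<rho> p = phi (KGamma 14) \<rho> p)))"
proof (intro conjI ballI impI allI)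
  fix \<rho> :: "real^2 \<Rightarrow> real" and p
  assume "smooth \<rho>"
  \<comment> \<open>Commutation is oriented as a rewrite rule that moves derivatives in direction 1
    outwards. With \<open>smooth_partial\<close> discharging its condition, every iterated
    derivative reaches a sorted normal form, and each equality becomes, in both components, a
    polynomial identity for \<open>algebra_simps\<close>.\<close>
  have commute: "partial 2 (partial 1 \<sigma>) = partial 1 (partial 2 \<sigma>)" if "smooth \<sigma>" for \<sigma>
    using that by (rule partial_commute)
  note evaluate = KGamma_def phi_three_component in_indices_def decorated_edges_def levi_civita_def
    commute smooth_partial \<open>smooth \<rho>\<close>
  show "phi (KGamma 1) \<rho> p = phi (KGamma 5) \<rho> p"
    unfolding vec_eq_iff forall_2 by (simp add: evaluate algebra_simps)
  show "phi (KGamma 5) \<rho> p = phi (KGamma 6) \<rho> p"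
    unfolding vec_eq_iff forall_2 by (simp add: evaluate algebra_simps)
  show "phi (KGamma 6) \<rho> p = - phi (KGamma 7) \<rho> p"
    unfolding vec_eq_iff forall_2 by (simp add: evaluate algebra_simps)
  show "- phi (KGamma 7) \<rho> p = (1/2) *\<^sub>R phi (KGamma 8) \<rho> p"
    unfolding vec_eq_iff forall_2 by (simp add: evaluate algebra_simps)
  show "(1/2) *\<^sub>R phi (KGamma 8) \<rho> p = phi (KGamma 12) \<rho> p"
    unfolding vec_eq_iff forall_2 by (simp add: evaluate algebra_simps)
  show "phi (KGamma 12) \<rho> p = phi (KGamma 13) \<rho> p"
    unfolding vec_eq_iff forall_2 by (simp add: evaluate algebra_simps)
  show "phi (KGamma 2) \<rho> p = phi (KGamma 4) \<rho> p"
    unfolding vec_eq_iff forall_2 by (simp add: evaluate algebra_simps)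
  show "phi (KGamma 4) \<rho> p = - phi (KGamma 9) \<rho> p"
    unfolding vec_eq_iff forall_2 by (simp add: evaluate algebra_simps)
  show "- phi (KGamma 9) \<rho> p = phi (KGamma 11) \<rho> p"
    unfolding vec_eq_iff forall_2 by (simp add: evaluate algebra_simps)
  show "phi (KGamma 3) \<rho> p = phi (KGamma 10) \<rho> p"
    unfolding vec_eq_iff forall_2 by (simp add: evaluate algebra_simps)
  show "phi (KGamma 10) \<rho> p = phi (KGamma 14) \<rho> p"
    unfolding vec_eq_iff forall_2 by (simp add: evaluate algebra_simps)
qed (rule KGamma_not_isomorphic)

end
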